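(* Consider the flow-level coflow scheduling problem on $m$ identical parallel network cores, defined in the context below. Let FLPT be the following algorithm. Initialize $load_I(i,h)=0$ and $load_O(j,h)=0$ for all input ports $i$, output ports $j$ and cores $h\in\{1,\dots,m\}$, and $\mathcal{A}_h=\emptyset$ for all $h$. For each flow $(i,j,k)\in\mathcal{F}$, taken in non-increasing order of $d_{i,j,k}$ (ties broken arbitrarily), let $h^*=\arg\min_{h}\{load_I(i,h)+load_O(j,h)\}$; add $(i,j,k)$ to $\mathcal{A}_{h^*}$ and increase both $load_I(i,h^* )$ and $load_O(j,h^* )$ by $d_{i,j,k}$. Output the assignment $\{\mathcal{A}_h\}_{h=1}^m$ (every flow of $\mathcal{A}_h$ is transmitted entirely on core $h$). Then FLPT is a $\left(\frac{8}{3}-\frac{2}{3m}\right)$-approximation algorithm: if $T$ is the makespan of the schedule found by FLPT and $T^*$ is the optimal makespan, then $T\le \left(\frac{8}{3}-\frac{2}{3m}\right)T^*$.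
   Context: Identical parallel networks: there are $m$ network cores, each a non-blocking $N\times N$ switch with input ports $\mathcal{I}=\{1,\dots,N\}$ and output ports $\mathcal{J}=\{1,\dots,N\}$; the $i$-th source server is connected to input port $i$ of every core and the $j$-th destination server to output port $j$ of every core. Every port of every core can transfer at most one unit of data per unit of time. A set $\mathcal{K}=\{1,\dots,K\}$ of coflows is given, all released at time $0$; coflow $k$ is an $N\times N$ matrix $D^{(k)}$ of nonnegative integers, and each nonzero entry $d_{i,j,k}$ is a flow $(i,j,k)$ that must transfer $d_{i,j,k}$ units of data from input port $i$ to output port $j$. $\mathcal{F}$ is the set of all flows. In the flow-level scheduling problem, each flow must be transmitted entirely through a single core (flows may not be split across cores), but different flows of the same coflow may use different cores. The completion time $C_k$ of coflow $k$ is the time at which its last flow finishes, and the makespan is $\max_k C_k$; $T^*$ denotes the minimum makespan over all feasible flow-level schedules. *)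

theory Defs
  imports Complex_Main
begin

text \<open>A flow \<open>(i, j, k)\<close> goes from input port \<open>i\<close> to output port \<open>j\<close> on behalf of coflow \<open>k\<close>.\<close>

type_synonym flow = "nat \<times> nat \<times> nat"

text \<open>\<open>D k i j\<close> is the entry of the demand matrix of coflow \<open>k\<close> at row \<open>i\<close> and column \<open>j\<close>.\<close>

type_synonym demand = "nat \<Rightarrow> nat \<Rightarrow> nat \<Rightarrow> nat"

fun inport :: "flow \<Rightarrow> nat" where "inport (i, j, k) = i"
fun outport :: "flow \<Rightarrow> nat" where "outport (i, j, k) = j"
fun coflow_of :: "flow \<Rightarrow> nat" where "coflow_of (i, j, k) = k"

fun flow_size :: "demand \<Rightarrow> flow \<Rightarrow> nat" where
  "flow_size D (i, j, k) = D k i j"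

definition flows :: "nat \<Rightarrow> nat \<Rightarrow> demand \<Rightarrow> flow set" where
  "flows N K D = {f \<in> {1..N} \<times> {1..N} \<times> {1..K}. flow_size D f > 0}"

text \<open>
  A schedule is a pair \<open>c\<close>, \<open>X\<close>: the flow \<open>f\<close> uses only the core \<open>c f\<close> (flows are not split
  across cores), and \<open>X f t\<close> is the amount of data of \<open>f\<close> transferred during the time
  interval \<open>[0, t]\<close>.  The capacity constraint says that in every time interval \<open>[s, t]\<close>
  each port of each core transfers at most \<open>t - s\<close> units of data.  Transmissions may be
  interrupted and resumed; the schedules that serve at most one flow per port at a time are
  the special case in which \<open>X f\<close> has slope \<open>0\<close> or \<open>1\<close>.
\<close>

definition feasible_schedule ::
    "nat \<Rightarrow> nat \<Rightarrow> nat \<Rightarrow> demand \<Rightarrow> (flow \<Rightarrow> nat) \<Rightarrow> (flow \<Rightarrow> real \<Rightarrow> real) \<Rightarrow> bool" where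
  "feasible_schedule m N K D c X \<longleftrightarrow>
     (\<forall>f\<in>flows N K D.
        c f \<in> {1..m} \<and>
        X f 0 = 0 \<and> mono_on {0..} (X f) \<and>
        (\<forall>t\<ge>0. X f t \<le> real (flow_size D f)) \<and>
        (\<exists>t\<ge>0. X f t = real (flow_size D f))) \<and>
     (\<forall>h\<in>{1..m}. \<forall>s t. 0 \<le> s \<longrightarrow> s \<le> t \<longrightarrow>
        (\<forall>i\<in>{1..N}. (\<Sum>f | f \<in> flows N K D \<and> c f = h \<and> inport f = i. X f t - X f s) \<le> t - s) \<and>
        (\<forall>j\<in>{1..N}. (\<Sum>f | f \<in> flows N K D \<and> c f = h \<and> outport f = j. X f t - X f s) \<le> t - s))"

definition flow_completion :: "demand \<Rightarrow> (flow \<Rightarrow> real \<Rightarrow> real) \<Rightarrow> flow \<Rightarrow> real" where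
  "flow_completion D X f = Inf {t. 0 \<le> t \<and> X f t = real (flow_size D f)}"

text \<open>A coflow without flows is complete at time \<open>0\<close>, its release time.\<close>

definition coflow_completion ::
    "nat \<Rightarrow> nat \<Rightarrow> demand \<Rightarrow> (flow \<Rightarrow> real \<Rightarrow> real) \<Rightarrow> nat \<Rightarrow> real" where
  "coflow_completion N K D X k =
     Max (insert 0 (flow_completion D X ` {f \<in> flows N K D. coflow_of f = k}))"

definition makespan :: "nat \<Rightarrow> nat \<Rightarrow> demand \<Rightarrow> (flow \<Rightarrow> real \<Rightarrow> real) \<Rightarrow> real" where
  "makespan N K D X = Max (insert 0 (coflow_completion N K D X ` {1..K}))"

text \<open>
  For \<open>m \<ge> 1\<close> the infima in the next two definitions are minima: once the cores of the flows
  are fixed, constant rates attain the lower bound given by the largest load of a port.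
\<close>

definition opt_makespan :: "nat \<Rightarrow> nat \<Rightarrow> nat \<Rightarrow> demand \<Rightarrow> real" where
  "opt_makespan m N K D = Inf {makespan N K D X | c X. feasible_schedule m N K D c X}"

text \<open>
  The makespan that results from an assignment \<open>A\<close> of the flows to the cores is the minimum
  makespan over the feasible schedules that transmit exactly the flows of \<open>A h\<close> on core \<open>h\<close>.
\<close>

definition assignment_makespan ::
    "nat \<Rightarrow> nat \<Rightarrow> nat \<Rightarrow> demand \<Rightarrow> (nat \<Rightarrow> flow set) \<Rightarrow> real" where
  "assignment_makespan m N K D A =
     Inf {makespan N K D X | c X. feasible_schedule m N K D c X \<and>
            (\<forall>h\<in>{1..m}. A h = {f \<in> flows N K D. c f = h})}"

record flpt_state =
  load_in :: "nat \<Rightarrow> nat \<Rightarrow> nat"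
  load_out :: "nat \<Rightarrow> nat \<Rightarrow> nat"
  assigned :: "nat \<Rightarrow> flow set"

definition flpt_init :: flpt_state where
  "flpt_init = \<lparr>load_in = \<lambda>i h. 0, load_out = \<lambda>j h. 0, assigned = \<lambda>h. {}\<rparr>"

definition flpt_add :: "demand \<Rightarrow> flow \<Rightarrow> nat \<Rightarrow> flpt_state \<Rightarrow> flpt_state" where
  "flpt_add D f h s =
     \<lparr>load_in = (\<lambda>i h'. load_in s i h' + (if i = inport f \<and> h' = h then flow_size D f else 0)),
      load_out = (\<lambda>j h'. load_out s j h' + (if j = outport f \<and> h' = h then flow_size D f else 0)),
      assigned = (assigned s)(h := insert f (assigned s h))\<rparr>"

text \<open>The run is a relation because a minimising core need not be unique.\<close>

inductive flpt_run :: "nat \<Rightarrow> demand \<Rightarrow> flpt_state \<Rightarrow> flow list \<Rightarrow> flpt_state \<Rightarrow> bool"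
  for m D where
  Nil: "flpt_run m D s [] s"
| Cons: "is_arg_min (\<lambda>h. load_in s (inport f) h + load_out s (outport f) h) (\<lambda>h. h \<in> {1..m}) h \<Longrightarrow>
         flpt_run m D (flpt_add D f h s) fs s' \<Longrightarrow> flpt_run m D s (f # fs) s'"

definition flpt_output :: "nat \<Rightarrow> nat \<Rightarrow> nat \<Rightarrow> demand \<Rightarrow> (nat \<Rightarrow> flow set) \<Rightarrow> bool" where
  "flpt_output m N K D A \<longleftrightarrow>
     (\<exists>fs s. distinct fs \<and> set fs = flows N K D \<and>
        sorted_wrt (\<lambda>f g. flow_size D f \<ge> flow_size D g) fs \<and>
        flpt_run m D flpt_init fs s \<and> A = assigned s)"

end

theory Submission
  imports Defs
begin

text \<open>
  Once the cores of the flows are fixed, the best makespan is the largest load of a port of a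
  core, so only port loads matter.  Let \<open>M\<close> be the makespan of any feasible schedule, and let \<open>f\<close>
  be a flow of size \<open>d\<close> that FLPT adds to a core whose ports of \<open>f\<close> carry the total load \<open>a\<close>.
  As \<open>a\<close> is minimal among the \<open>m\<close> cores, averaging gives \<open>m a \<le> 2 (m M - d)\<close>, which suffices
  if \<open>d \<le> M / 2\<close>.  If \<open>d > M / 2\<close>, then all flows considered so far are larger than \<open>M / 2\<close>, so that
  the schedule sends at most \<open>m\<close> of them through each port.  Hence before \<open>f\<close> is added the two ports
  carry at most \<open>2 (m - 1)\<close> flows, some core has at most one of them, and \<open>a \<le> M\<close>.
\<close>

section \<open>Loads of the ports of a core\<close>

text \<open>The weight is a parameter because two kinds are needed: flow sizes give loads, and the
  constant weight 1 counts flows. The selector \<open>p\<close> is \<open>inport\<close> or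
  \<open>outport\<close>, so that both sides share their lemmas.\<close>

definition port_load ::
    "(flow \<Rightarrow> real) \<Rightarrow> flow set \<Rightarrow> (flow \<Rightarrow> nat) \<Rightarrow> (flow \<Rightarrow> nat) \<Rightarrow> nat \<Rightarrow> nat \<Rightarrow> real" where
  "port_load w S c p i h = (\<Sum>f | f \<in> S \<and> c f = h \<and> p f = i. w f)"

lemma port_load_empty [simp]: "port_load w {} c p i h = 0"
  by (simp add: port_load_def)

lemma port_load_insert:
  assumes "finite S" "f \<notin> S"
  shows "port_load w (insert f S) c p i h =
    port_load w S c p i h + (if c f = h \<and> p f = i then w f else 0)"
proof -
  have "{g. g \<in> insert f S \<and> c g = h \<and> p g = i} =
     (if c f = h \<and> p f = i then insert f {g. g \<in> S \<and> c g = h \<and> p g = i}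
      else {g. g \<in> S \<and> c g = h \<and> p g = i})"
    by auto
  then show ?thesis
    using assms by (simp add: port_load_def)
qed

text \<open>The cores partition \<open>S\<close>. The total over the cores therefore does not depend
  on \<open>c\<close>, which lets two assignments be compared.\<close>

lemma sum_port_load:
  assumes "finite S" "\<And>f. f \<in> S \<Longrightarrow> c f \<in> {1..m}"
  shows "(\<Sum>h\<in>{1..m}. port_load w S c p i h) = (\<Sum>f | f \<in> S \<and> p f = i. w f)"
proof -
  have "(\<Sum>f | f \<in> S \<and> p f = i. w f) =
      (\<Sum>h\<in>{1..m}. \<Sum>f | f \<in> {f. f \<in> S \<and> p f = i} \<and> c f = h. w f)"
    using assms by (intro sum.group[symmetric]) auto
  also have "\<dots> = (\<Sum>h\<in>{1..m}. port_load w S c p i h)"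
    unfolding port_load_def by (intro sum.cong) auto
  finally show ?thesis by simp
qed

lemma port_load_mono:
  assumes "finite T" "S \<subseteq> T" "\<And>f. f \<in> T \<Longrightarrow> 0 \<le> w f"
  shows "port_load w S c p i h \<le> port_load w T c p i h"
  unfolding port_load_def using assms by (intro sum_mono2) auto

lemma finite_flows [simp]: "finite (flows N K D)"
  unfolding flows_def by (rule finite_subset[of _ "{1..N} \<times> {1..N} \<times> {1..K}"]) auto

lemma flows_ports:
  assumes "f \<in> flows N K D"
  shows "inport f \<in> {1..N}" "outport f \<in> {1..N}" "coflow_of f \<in> {1..K}"
    and "0 < flow_size D f"
  using assms by (auto simp: flows_def)

section \<open>Makespan and port loads\<close>

lemma makespan_nonneg: "0 \<le> makespan N K D X"
  unfolding makespan_def by (intro Max_ge) auto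

lemma bdd_below_makespan: "bdd_below {makespan N K D X | c X. P c X}"
  by (rule bdd_belowI[of _ 0]) (auto simp: makespan_nonneg)

lemma flow_completion_le_makespan:
  assumes "f \<in> flows N K D"
  shows "flow_completion D X f \<le> makespan N K D X"
proof -
  have "flow_completion D X f \<le> coflow_completion N K D X (coflow_of f)"
    unfolding coflow_completion_def using assms by (intro Max_ge) auto
  also have "\<dots> \<le> makespan N K D X"
    unfolding makespan_def using flows_ports(3)[OF assms] by (intro Max_ge) auto
  finally show ?thesis .
qed

text \<open>Some completion time of \<open>f\<close> lies strictly below \<open>t\<close>, and
  monotonicity carries completion on to \<open>t\<close>. The strict inequality spares a continuity
  argument for the infimum.\<close>

lemma flow_complete_after_makespan:
  assumes X: "feasible_schedule m N K D c X" and f: "f \<in> flows N K D"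
    and t: "makespan N K D X < t"
  shows "X f t = real (flow_size D f)"
proof -
  let ?S = "{t. 0 \<le> t \<and> X f t = real (flow_size D f)}"
  have mono: "mono_on {0..} (X f)" and le: "\<And>t. t \<ge> 0 \<Longrightarrow> X f t \<le> real (flow_size D f)"
    and ex: "\<exists>t\<ge>0. X f t = real (flow_size D f)"
    using X f unfolding feasible_schedule_def by blast+
  have "Inf ?S < t"
    using flow_completion_le_makespan[OF f, of X] t by (simp add: flow_completion_def)
  moreover have "?S \<noteq> {}" using ex by auto
  ultimately obtain s where s: "s \<in> ?S" "s < t"
    using cInf_lessD by metis
  have "X f s \<le> X f t"
    using s by (intro mono_onD[OF mono]) auto
  then show ?thesis using s le[of t] by auto
qed

text \<open>At any time \<open>t\<close> beyond the makespan the whole load has passed through the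
  port, so the capacity on \<open>[0, t]\<close> bounds it by \<open>t\<close>; then
  \<open>t\<close> decreases to the makespan.\<close>

lemma port_load_le_makespan:
  assumes X: "feasible_schedule m N K D c X" and p: "p \<in> {inport, outport}"
    and h: "h \<in> {1..m}"
  shows "port_load (\<lambda>f. real (flow_size D f)) (flows N K D) c p i h \<le> makespan N K D X"
proof (cases "i \<in> {1..N}")
  case True
  show ?thesis
  proof (rule dense_ge)
    fix t assume t: "makespan N K D X < t"
    have t0: "0 \<le> t" using makespan_nonneg[of N K D X] t by linarith
    have "(\<Sum>f | f \<in> flows N K D \<and> c f = h \<and> p f = i. X f t - X f 0) \<le> t - 0"
      using conjunct2[OF X[unfolded feasible_schedule_def], rule_format, OF h _ t0] True p
      by blast
    moreover have "X f t - X f 0 = real (flow_size D f)" if "f \<in> flows N K D" for f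
      using flow_complete_after_makespan[OF X that t] X that
      by (simp add: feasible_schedule_def)
    ultimately show
      "port_load (\<lambda>f. real (flow_size D f)) (flows N K D) c p i h \<le> t"
      unfolding port_load_def by simp
  qed
next
  case False
  then have "{f. f \<in> flows N K D \<and> c f = h \<and> p f = i} = {}"
    using p flows_ports by blast
  then show ?thesis unfolding port_load_def by (simp only: sum.empty makespan_nonneg)
qed

text \<open>Transmitting every flow at a constant rate during \<open>[0, B]\<close> meets the capacities.\<close>

lemma schedule_from_port_loads:
  assumes c: "\<And>f. f \<in> flows N K D \<Longrightarrow> c f \<in> {1..m}" and B: "0 < B"
    and load: "\<And>p i h. p \<in> {inport, outport} \<Longrightarrow> h \<in> {1..m} \<Longrightarrow>
      port_load (\<lambda>f. real (flow_size D f)) (flows N K D) c p i h \<le> B"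
  obtains X where "feasible_schedule m N K D c X" "makespan N K D X \<le> B"
proof
  define X where "X = (\<lambda>f t. real (flow_size D f) * min 1 (t / B))"
  have cap: "(\<Sum>f | f \<in> flows N K D \<and> c f = h \<and> p f = i. X f t - X f s) \<le> t - s"
    if "p \<in> {inport, outport}" "h \<in> {1..m}" "0 \<le> s" "s \<le> t" for p i h s t
  proof -
    \<comment> \<open>The fraction of a flow sent during \<open>[s, t]\<close>; it is the same for
      all flows and at most \<open>(t - s) / B\<close>.\<close>
    let ?r = "min 1 (t / B) - min 1 (s / B)"
    have st: "s / B \<le> t / B" using that B by (intro divide_right_mono) auto
    have r0: "0 \<le> ?r" and r1: "?r \<le> t / B - s / B"
      using st by (auto simp: min_def)
    have "(\<Sum>f | f \<in> flows N K D \<and> c f = h \<and> p f = i. X f t - X f s) =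
        port_load (\<lambda>f. real (flow_size D f)) (flows N K D) c p i h * ?r"
      unfolding X_def port_load_def by (simp add: sum_distrib_right right_diff_distrib sum_subtractf)
    also have "\<dots> \<le> B * ?r" using load[OF that(1,2)] r0 by (rule mult_right_mono)
    also have "\<dots> \<le> B * (t / B - s / B)" using r1 B by (intro mult_left_mono) auto
    also have "\<dots> = t - s" using B by (simp add: field_simps)
    finally show ?thesis .
  qed
  have XB: "X f B = real (flow_size D f)" for f using B by (simp add: X_def)
  have mono: "mono_on {0..} (X f)" for f
  proof (rule mono_onI)
    fix s t :: real assume "s \<le> t"
    then have "s / B \<le> t / B" using B by (intro divide_right_mono) auto
    then show "X f s \<le> X f t"
      unfolding X_def by (intro mult_left_mono min.mono) auto
  qed
  have le: "X f t \<le> real (flow_size D f)" for f t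
    unfolding X_def by (rule mult_left_le) auto
  have X0: "X f 0 = 0" for f by (simp add: X_def)
  have ex: "\<exists>t\<ge>0. X f t = real (flow_size D f)" for f using XB B less_imp_le by blast
  show "feasible_schedule m N K D c X"
    unfolding feasible_schedule_def
    by (intro conjI ballI allI impI c mono le X0 ex cap) simp_all
  have "flow_completion D X f \<le> B" for f
    unfolding flow_completion_def using XB B
    by (intro cInf_lower bdd_belowI[of _ 0]) auto
  then show "makespan N K D X \<le> B"
    unfolding makespan_def coflow_completion_def using B by auto
qed

lemma assignment_makespan_le:
  assumes c: "\<And>f. f \<in> flows N K D \<Longrightarrow> c f \<in> {1..m}" and B: "0 \<le> B"
    and load: "\<And>p i h. p \<in> {inport, outport} \<Longrightarrow> h \<in> {1..m} \<Longrightarrow>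
      port_load (\<lambda>f. real (flow_size D f)) (flows N K D) c p i h \<le> B"
    and A: "\<And>h. A h = {f \<in> flows N K D. c f = h}"
  shows "assignment_makespan m N K D A \<le> B"
proof (rule dense_ge)
  \<comment> \<open>The constant-rate schedule needs a positive length, whereas \<open>B\<close> may
    be 0.\<close>
  fix B' assume B': "B < B'"
  obtain X where X: "feasible_schedule m N K D c X" "makespan N K D X \<le> B'"
  proof (rule schedule_from_port_loads[of N K D c m B'])
    show "port_load (\<lambda>f. real (flow_size D f)) (flows N K D) c p i h \<le> B'"
      if "p \<in> {inport, outport}" "h \<in> {1..m}" for p i h
      using load[OF that, of i] B' by linarith
  qed (use c B B' in auto)
  have "assignment_makespan m N K D A \<le> makespan N K D X"
    unfolding assignment_makespan_def using X(1) A
    by (intro cInf_lower bdd_below_makespan) blast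
  then show "assignment_makespan m N K D A \<le> B'" using X(2) by linarith
qed

section \<open>The greedy assignment\<close>

text \<open>Replaces the state of the algorithm by a core function and port loads of list prefixes.
  The loads of \<open>s\<close> stay in the inequality so that the induction can start from an
  arbitrary state.\<close>

lemma flpt_run_cores:
  assumes "flpt_run m D s fs s'" "distinct fs"
  obtains c where "\<And>f. f \<in> set fs \<Longrightarrow> c f \<in> {1..m}"
    and "\<And>h. assigned s' h = assigned s h \<union> {f \<in> set fs. c f = h}"
    and "\<And>xs f ys h. fs = xs @ f # ys \<Longrightarrow> h \<in> {1..m} \<Longrightarrow>
       real (load_in s (inport f) (c f)) + real (load_out s (outport f) (c f)) +
         port_load (\<lambda>f. real (flow_size D f)) (set xs) c inport (inport f) (c f) +
         port_load (\<lambda>f. real (flow_size D f)) (set xs) c outport (outport f) (c f)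
       \<le> real (load_in s (inport f) h) + real (load_out s (outport f) h) +
         port_load (\<lambda>f. real (flow_size D f)) (set xs) c inport (inport f) h +
         port_load (\<lambda>f. real (flow_size D f)) (set xs) c outport (outport f) h"
  using assms
proof (induction arbitrary: thesis rule: flpt_run.induct)
  case (Nil s)
  show ?case by (rule Nil.prems(1)[of "\<lambda>_. 0"]) auto
next
  case (Cons s f h fs s')
  let ?w = "\<lambda>f. real (flow_size D f)"
  let ?s = "flpt_add D f h s"
  obtain c where c: "\<And>g. g \<in> set fs \<Longrightarrow> c g \<in> {1..m}"
    and as: "\<And>h'. assigned s' h' = assigned ?s h' \<union> {g \<in> set fs. c g = h'}"
    and ge: "\<And>xs g ys h'. fs = xs @ g # ys \<Longrightarrow> h' \<in> {1..m} \<Longrightarrow>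
       real (load_in ?s (inport g) (c g)) + real (load_out ?s (outport g) (c g)) +
         port_load ?w (set xs) c inport (inport g) (c g) +
         port_load ?w (set xs) c outport (outport g) (c g)
       \<le> real (load_in ?s (inport g) h') + real (load_out ?s (outport g) h') +
         port_load ?w (set xs) c inport (inport g) h' +
         port_load ?w (set xs) c outport (outport g) h'"
  proof (rule Cons.IH, goal_cases)
    case (1 c)
    from 1(2-4) show ?case by (rule 1(1))
  qed (use Cons.prems(2) in simp)
  have f: "f \<notin> set fs" using Cons.prems(2) by simp
  have h: "h \<in> {1..m}"
    and min: "\<And>h'. h' \<in> {1..m} \<Longrightarrow>
       load_in s (inport f) h + load_out s (outport f) h
       \<le> load_in s (inport f) h' + load_out s (outport f) h'"
    using Cons.hyps(1) by (auto simp: is_arg_min_linorder)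
  let ?c = "c(f := h)"
  show ?case
  proof (rule Cons.prems(1)[of ?c])
    show "?c g \<in> {1..m}" if "g \<in> set (f # fs)" for g
      using that h c[of g] by auto
    show "assigned s' h' = assigned s h' \<union> {g \<in> set (f # fs). ?c g = h'}" for h'
      unfolding as using f by (auto simp: flpt_add_def)
  next
    fix xs g ys h'
    assume split: "f # fs = xs @ g # ys" and h': "h' \<in> {1..m}"
    show "real (load_in s (inport g) (?c g)) + real (load_out s (outport g) (?c g)) +
         port_load ?w (set xs) ?c inport (inport g) (?c g) +
         port_load ?w (set xs) ?c outport (outport g) (?c g)
       \<le> real (load_in s (inport g) h') + real (load_out s (outport g) h') +
         port_load ?w (set xs) ?c inport (inport g) h' +
         port_load ?w (set xs) ?c outport (outport g) h'"
    proof (cases xs)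
      case Nil
      then show ?thesis using split min[OF h'] by simp
    next
      case (Cons x xs')
      then have x: "x = f" and fs: "fs = xs' @ g # ys" using split by auto
      have fx: "f \<notin> set xs'" and fg: "g \<noteq> f" using f fs by auto
      \<comment> \<open>What \<open>f\<close> adds to the port loads of the longer prefix is what
        \<open>flpt_add\<close> adds to the loads of \<open>s\<close>.\<close>
      have eq: "port_load ?w (set xs) ?c p i h'' =
          port_load ?w (set xs') c p i h'' + (if h = h'' \<and> p f = i then ?w f else 0)" for p i h''
      proof -
        have "port_load ?w (set xs') ?c p i h'' = port_load ?w (set xs') c p i h''"
          unfolding port_load_def using fx by (intro sum.cong) auto
        then show ?thesis
          using port_load_insert[of "set xs'" f ?w ?c] fx by (simp add: Cons x)
      qed
      show ?thesis
        using ge[OF fs h'] fg unfolding eq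
        by (auto simp: flpt_add_def split: if_splits)
    qed
  qed
qed

section \<open>Load bound for a single greedy step\<close>

text \<open>In the application \<open>S\<close> holds the flows placed before \<open>f\<close>,
  \<open>c\<close> is the greedy assignment, and \<open>c'\<close> comes from a competing schedule
  of makespan \<open>M\<close>. With \<open>a\<close> the total load of the two ports of
  \<open>f\<close> on the chosen core, \<open>a + w f\<close> bounds the new load of each of
  them.\<close>

lemma greedy_load_bound:
  fixes w :: "flow \<Rightarrow> real"
  assumes m: "m \<ge> 1" and S: "finite S" "f \<notin> S"
    and c: "\<And>g. g \<in> S \<Longrightarrow> c g \<in> {1..m}"
    and c': "\<And>g. g \<in> insert f S \<Longrightarrow> c' g \<in> {1..m}"
    and large: "\<And>g. g \<in> S \<Longrightarrow> w f \<le> w g" and w0: "0 \<le> w f"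
    and M: "\<And>p i h. p \<in> {inport, outport} \<Longrightarrow> h \<in> {1..m} \<Longrightarrow>
       port_load w (insert f S) c' p i h \<le> M"
    and min: "\<And>h. h \<in> {1..m} \<Longrightarrow>
       a \<le> port_load w S c inport (inport f) h + port_load w S c outport (outport f) h"
  shows "a + w f \<le> (8 / 3 - 2 / (3 * real m)) * M"
proof -
  have nonneg: "0 \<le> w g" if "g \<in> insert f S" for g
    using that large[of g] w0 by auto
  have wM: "w g \<le> M" if g: "g \<in> insert f S" for g
  proof -
    have "w g \<le> port_load w (insert f S) c' inport (inport g) (c' g)"
      unfolding port_load_def using g S nonneg by (intro member_le_sum) auto
    also have "\<dots> \<le> M" using M c'[OF g] by blast
    finally show ?thesis .
  qed
  have M0: "0 \<le> M" using wM[of f] w0 by simp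
  \<comment> \<open>At either port of \<open>f\<close>, the competing assignment carries
    \<open>f\<close> and the flows of \<open>S\<close> within total weight \<open>m L\<close>, so
    \<open>S\<close> alone weighs at most \<open>m L - v f\<close> there. The weight
    \<open>v\<close> is general because sizes and counts are both needed.\<close>
  have average: "real m * b \<le> 2 * (real m * L) - 2 * v f"
    if b: "\<And>h. h \<in> {1..m} \<Longrightarrow>
       b \<le> port_load v S c inport (inport f) h + port_load v S c outport (outport f) h"
      and L: "\<And>p i h. p \<in> {inport, outport} \<Longrightarrow> h \<in> {1..m} \<Longrightarrow>
       port_load v (insert f S) c' p i h \<le> L"
    for v :: "flow \<Rightarrow> real" and b L
  proof -
    have total: "(\<Sum>h\<in>{1..m}. port_load v S c p (p f) h) \<le> real m * L - v f"
      if p: "p \<in> {inport, outport}" for p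
    proof -
      have "{g. g \<in> insert f S \<and> p g = p f} = insert f {g. g \<in> S \<and> p g = p f}" by auto
      then have "(\<Sum>g | g \<in> S \<and> p g = p f. v g) + v f = (\<Sum>g | g \<in> insert f S \<and> p g = p f. v g)"
        using S by simp
      also have "\<dots> = (\<Sum>h\<in>{1..m}. port_load v (insert f S) c' p (p f) h)"
        using S c' by (intro sum_port_load[symmetric]) auto
      also have "\<dots> \<le> (\<Sum>h\<in>{1..m}. L)" using L p by (intro sum_mono) auto
      finally have "(\<Sum>g | g \<in> S \<and> p g = p f. v g) + v f \<le> real m * L" by simp
      then show ?thesis using sum_port_load[OF S(1) c, where w = v and p = p and i = "p f"] by simp
    qed
    have "real m * b = (\<Sum>h\<in>{1..m}. b)" by simp
    also have "\<dots> \<le> (\<Sum>h\<in>{1..m}.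
       port_load v S c inport (inport f) h + port_load v S c outport (outport f) h)"
      using b by (intro sum_mono) auto
    finally show ?thesis
      using total[of inport] total[of outport] by (simp add: sum.distrib)
  qed
  show ?thesis
  proof (cases "w f \<le> M / 2")
    case True
    \<comment> \<open>Averaging leaves \<open>m (a + w f) \<le> 2 m M + (m - 2) w f\<close>. For
      \<open>m = 1\<close> the last coefficient is negative, so \<open>w f \<le> M / 2\<close>
      cannot be inserted, but the right side below is 0. For \<open>m \<ge> 2\<close> the
      coefficients of \<open>M\<close> differ by \<open>m / 6 + 1 / 3\<close>.\<close>
    have "(real m - 2) * w f \<le> (2 * real m / 3 - 2 / 3) * M"
    proof (cases "m = 1")
      case True
      then show ?thesis using w0 M0 by simp
    next
      case False
      then have m2: "real m \<ge> 2" using m by simp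
      have "(real m - 2) * w f \<le> (real m - 2) * (M / 2)"
        using True m2 by (intro mult_left_mono) auto
      also have "\<dots> = (real m / 2 - 1) * M" by (simp add: field_simps)
      also have "\<dots> \<le> (2 * real m / 3 - 2 / 3) * M"
        using M0 m2 by (intro mult_right_mono) auto
      finally show ?thesis .
    qed
    then have "real m * (a + w f) \<le> (8 * real m / 3 - 2 / 3) * M"
      using average[OF min M] by (simp add: algebra_simps)
    also have "\<dots> = real m * ((8 / 3 - 2 / (3 * real m)) * M)"
      using m by (simp add: field_simps)
    finally show ?thesis using m by (simp add: mult_le_cancel_left_pos)
  next
    case False
    \<comment> \<open>Two flows of size at least \<open>w f > M / 2\<close> would overload a port of
      a core.\<close>
    have one: "port_load (\<lambda>_. 1) (insert f S) c' p i h \<le> 1"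
      if "p \<in> {inport, outport}" "h \<in> {1..m}" for p i h
    proof -
      let ?F = "{g. g \<in> insert f S \<and> c' g = h \<and> p g = i}"
      have "real (card ?F) * w f = (\<Sum>g\<in>?F. w f)" by simp
      also have "\<dots> \<le> port_load w (insert f S) c' p i h"
        unfolding port_load_def using large by (intro sum_mono) auto
      also have "\<dots> < 2 * w f" using M[OF that, of i] False by simp
      finally have "card ?F < 2" using w0 by (simp add: mult_less_cancel_right)
      then show ?thesis unfolding port_load_def by simp
    qed
    \<comment> \<open>Otherwise averaging with unit weights, \<open>b = 2\<close> and
      \<open>L = 1\<close> would give \<open>2 m \<le> 2 m - 2\<close>.\<close>
    have "\<exists>h\<in>{1..m}. port_load (\<lambda>_. 1) S c inport (inport f) h +
        port_load (\<lambda>_. 1) S c outport (outport f) h < 2"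
    proof (rule ccontr)
      assume "\<not> ?thesis"
      then have "real m * 2 \<le> 2 * (real m * 1) - 2 * 1"
        using one by (intro average) (auto simp: not_less)
      then show False by simp
    qed
    then obtain h where h: "h \<in> {1..m}" and
      "port_load (\<lambda>_. 1) S c inport (inport f) h +
        port_load (\<lambda>_. 1) S c outport (outport f) h < 2" by blast
    \<comment> \<open>Counts are integers, so less than 2 means at most 1.\<close>
    then have few: "port_load (\<lambda>_. 1) S c inport (inport f) h +
        port_load (\<lambda>_. 1) S c outport (outport f) h \<le> 1"
      unfolding port_load_def sum_constant mult_1_right of_nat_add[symmetric] of_nat_le_1_iff
      of_nat_less_numeral_iff by linarith
    have le: "port_load w S c p i h \<le> M * port_load (\<lambda>_. 1) S c p i h" for p i
      unfolding port_load_def sum_distrib_left using wM by (intro sum_mono) auto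
    have "a \<le> M * (port_load (\<lambda>_. 1) S c inport (inport f) h +
        port_load (\<lambda>_. 1) S c outport (outport f) h)"
      using min[OF h] le[of inport "inport f"] le[of outport "outport f"]
      by (simp add: distrib_left)
    also have "\<dots> \<le> M * 1" using few M0 by (rule mult_left_mono)
    finally have "a + w f \<le> 2 * M" using wM[of f] by simp
    \<comment> \<open>The ratio is at least 2, with equality for \<open>m = 1\<close>.\<close>
    also have "\<dots> \<le> (8 / 3 - 2 / (3 * real m)) * M"
      using M0 m by (intro mult_right_mono) (auto simp: field_simps)
    finally show ?thesis .
  qed
qed

section \<open>Comparison with the optimal makespan\<close>

theorem theorem2:
  fixes m N K :: nat and D :: demand and A :: "nat \<Rightarrow> flow set"
  assumes "m \<ge> 1" and "N \<ge> 1" and "K \<ge> 1"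
    and "flpt_output m N K D A"
  shows "assignment_makespan m N K D A \<le> (8 / 3 - 2 / (3 * real m)) * opt_makespan m N K D"
proof -
  let ?F = "flows N K D" and ?r = "8 / 3 - 2 / (3 * real m)"
  let ?w = "\<lambda>f. real (flow_size D f)"
  obtain fs s where fs: "distinct fs" "set fs = ?F"
    and sorted: "sorted_wrt (\<lambda>f g. flow_size D f \<ge> flow_size D g) fs"
    and run: "flpt_run m D flpt_init fs s" and A: "A = assigned s"
    using assms(4) unfolding flpt_output_def by blast
  obtain c where c: "\<And>f. f \<in> ?F \<Longrightarrow> c f \<in> {1..m}"
    and as: "\<And>h. A h = {f \<in> ?F. c f = h}"
    and greedy: "\<And>xs f ys h. fs = xs @ f # ys \<Longrightarrow> h \<in> {1..m} \<Longrightarrow>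
         port_load ?w (set xs) c inport (inport f) (c f) +
         port_load ?w (set xs) c outport (outport f) (c f)
       \<le> port_load ?w (set xs) c inport (inport f) h +
         port_load ?w (set xs) c outport (outport f) h"
  proof (rule flpt_run_cores[OF run fs(1)], goal_cases)
    case (1 c)
    show ?case
      by (rule 1(1)[of c]) (use 1(2-4) in \<open>simp_all add: flpt_init_def A fs(2)\<close>)
  qed
  have r: "0 < ?r" using assms(1) by (simp add: field_simps)
  have le: "assignment_makespan m N K D A \<le> ?r * makespan N K D X"
    if X: "feasible_schedule m N K D c' X" for c' X
  proof -
    let ?M = "makespan N K D X"
    have rM: "0 \<le> ?r * ?M" using r makespan_nonneg by (intro mult_nonneg_nonneg) auto
    have c': "c' f \<in> {1..m}" if "f \<in> ?F" for f
      using X that by (simp add: feasible_schedule_def)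
    \<comment> \<open>Induction along the run: a port load changes only when a flow is added to that
      port and core, and then \<open>greedy_load_bound\<close> applies to this flow.\<close>
    have prefix: "port_load ?w (set xs) c p i h \<le> ?r * ?M"
      if "fs = xs @ ys" "p \<in> {inport, outport}" "h \<in> {1..m}" for xs ys p i h
      using that
    proof (induction xs arbitrary: ys rule: rev_induct)
      case Nil
      then show ?case using rM by simp
    next
      case (snoc f xs)
      have split: "fs = xs @ f # ys" using snoc.prems(1) by simp
      have f: "f \<notin> set xs" using fs(1) split by auto
      have sub: "insert f (set xs) \<subseteq> ?F" using fs(2) split by auto
      let ?a = "port_load ?w (set xs) c inport (inport f) (c f) +
         port_load ?w (set xs) c outport (outport f) (c f)"
      have bound: "?a + ?w f \<le> ?r * ?M"
      proof (rule greedy_load_bound[where S = "set xs" and c = c and c' = c'])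
        show "port_load ?w (insert f (set xs)) c' p i h \<le> ?M"
          if "p \<in> {inport, outport}" "h \<in> {1..m}" for p i h
          using port_load_mono[OF finite_flows sub, where w = ?w and c = c' and p = p and i = i and h = h]
            port_load_le_makespan[OF X that, of i] by simp
        show "?w f \<le> ?w g" if "g \<in> set xs" for g
          using sorted that unfolding split sorted_wrt_append by auto
      qed (use assms(1) f sub c c' greedy[OF split] in auto)
      have nonneg: "0 \<le> port_load ?w (set xs) c q j h'" for q j h'
        unfolding port_load_def by (intro sum_nonneg) auto
      have "port_load ?w (set xs) c p (p f) (c f) \<le> ?a"
        using snoc.prems(2) nonneg by auto
      then show ?case
        using bound snoc.IH[OF split snoc.prems(2,3)] port_load_insert[OF finite_set f, of ?w c p i h]
        by auto
    qed
    show ?thesis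
      by (rule assignment_makespan_le[of N K D c]) (use c as rM prefix[of fs "[]"] fs(2) in auto)
  qed
  \<comment> \<open>After division by the positive ratio, the left side is a lower bound of the set
    whose infimum is the optimum.\<close>
  have "assignment_makespan m N K D A / ?r \<le> opt_makespan m N K D"
    unfolding opt_makespan_def
  proof (rule cInf_greatest)
    \<comment> \<open>The infimum needs a nonempty set. The total size bounds every port load, and
      the added 1 keeps \<open>B\<close> positive even without flows.\<close>
    define B where "B = 1 + (\<Sum>f\<in>?F. ?w f)"
    have "0 \<le> (\<Sum>f\<in>?F. ?w f)" by (intro sum_nonneg) auto
    then have B: "0 < B" by (simp add: B_def)
    have "port_load ?w ?F c p i h \<le> B" for p i h
    proof -
      have "port_load ?w ?F c p i h \<le> (\<Sum>f\<in>?F. ?w f)"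
        unfolding port_load_def by (intro sum_mono2) auto
      then show ?thesis by (simp add: B_def)
    qed
    then obtain X where "feasible_schedule m N K D c X"
      using schedule_from_port_loads[of N K D c m B, OF c B] by metis
    then show "{makespan N K D X | c X. feasible_schedule m N K D c X} \<noteq> {}" by blast
  next
    fix x assume "x \<in> {makespan N K D X | c X. feasible_schedule m N K D c X}"
    then show "assignment_makespan m N K D A / ?r \<le> x"
      using le r by (auto simp: pos_divide_le_eq mult.commute)
  qed
  then show ?thesis using r by (simp add: pos_divide_le_eq mult.commute)
qed

end
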